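(* Let $A\in\mathbb{R}^{m\times n}$ with $\operatorname{rank}(A)=n$, let $b\in\mathbb{R}^m$, let $R_s\in\mathbb{R}^{n\times n}$ be nonsingular, and set $A_p\equiv AR_s^{-1}$. Let $x_*\in\mathbb{R}^n$ be the exact solution of the preconditioned normal equations, that is, $A_p^TA_p\,y_*=A_p^Tb$ and $R_sx_*=y_*$. Let $E_s\in\mathbb{R}^{n\times n}$ and $E_A\in\mathbb{R}^{m\times n}$ with $\|E_s\|\,\|R_s^{-1}\|<1$, and set $$A_1\equiv (A+E_A)(R_s+E_s)^{-1},\qquad \epsilon_s\equiv\frac{\|E_s\|}{\|R_s\|},\qquad \epsilon_A\equiv\frac{\|E_A\|}{\|A\|}.$$ Let the computed solutions $\hat y,\hat x\in\mathbb{R}^n$ satisfy $$A_1^TA_1\hat y=A_1^Tb,\qquad (R_s+E_s)\hat x=\hat y.$$ If $\hat x\neq 0$ and $\hat y\neq 0$, then $$\frac{\|\hat x-x_*\|}{\|\hat x\|}\leq \kappa(R_s)\,\kappa(A_p)\,\epsilon_A\left(\kappa(A_p)\,\kappa(R_s)\,\frac{\|A\hat x-b\|}{\|A\|\,\|\hat x\|}+1+\kappa(A)\,\epsilon_A\right).$$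
   Context: $\|\cdot\|$ denotes the Euclidean two-norm (for matrices, the induced spectral norm). For a real matrix $M$ of full column rank, $M^\dagger\equiv(M^TM)^{-1}M^T$ is the Moore-Penrose inverse and $\kappa(M)\equiv\|M\|\,\|M^\dagger\|$ is the two-norm condition number with respect to left inversion (for nonsingular square $M$, $M^\dagger=M^{-1}$). *)

theory Defs
  imports "HOL-Analysis.Analysis"
begin

(* The library norm on the matrix type real^'n^'m is the Frobenius norm; the
   spectral norm is the operator norm induced by the Euclidean vector norms. *)
definition spectral_norm :: "real^'n^'m \<Rightarrow> real" where
  "spectral_norm M = onorm (\<lambda>x. M *v x)"

(* Meaningful only for M of full column rank, so that M^T M is invertible. *)
definition pinv :: "real^'n^'m \<Rightarrow> real^'m^'n" where
  "pinv M = matrix_inv (transpose M ** M) ** transpose M"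

definition cond_num :: "real^'n^'m \<Rightarrow> real" where
  "cond_num M = spectral_norm M * spectral_norm (pinv M)"

end

theory Submission
  imports Defs
begin

text \<open>Both preconditioned systems are normal equations in disguise: cancelling the preconditioners
gives $A^T(Ax_* - b) = 0$ and $(A+E_A)^T((A+E_A)\hat x - b) = 0$. Subtracting them, with
$r = A\hat x - b$,
$$\hat x - x_* = -A^\dagger E_A\hat x - (A^TA)^{-1}E_A^T(r + E_A\hat x),$$
and $(A^TA)^{-1} = A^\dagger(A^\dagger)^T$ gives the bound with $\kappa(A)$ in place of
$\kappa(R_s)\kappa(A_p)$. Finally $A = A_pR_s$ and $A^\dagger = R_s^{-1}A_p^\dagger$ imply
$\kappa(A) \le \kappa(R_s)\kappa(A_p)$.\<close>

section \<open>The spectral norm and its invariance under transposition\<close>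

lemma norm_mult_vec_le_spectral_norm: "norm (M *v x) \<le> spectral_norm M * norm x"
  unfolding spectral_norm_def by (rule onorm) simp

lemma spectral_norm_nonneg [simp]: "0 \<le> spectral_norm M"
  unfolding spectral_norm_def by (rule onorm_pos_le) simp

lemma spectral_norm_pos: "M \<noteq> 0 \<Longrightarrow> 0 < spectral_norm M"
  unfolding spectral_norm_def
  by (subst onorm_pos_lt) (auto simp: matrix_eq)

lemma spectral_norm_mult:
  fixes M :: "real^'k^'m" and N :: "real^'n^'k"
  shows "spectral_norm (M ** N) \<le> spectral_norm M * spectral_norm N"
  using onorm_compose[of "(*v) M" "(*v) N"]
  by (simp add: spectral_norm_def o_def matrix_vector_mul_assoc)

lemma inner_transpose_mult_vec:
  fixes M :: "real^'n^'m"
  shows "inner (transpose M *v x) y = inner x (M *v y)"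
  by (simp add: dot_lmul_matrix)

text \<open>For \<open>y = transpose M *v x\<close>, moving one factor across the inner product
  bounds the square of \<open>norm y\<close> by \<open>norm x * norm (M *v y)\<close>; dividing by
  \<open>norm y\<close> leaves the claim.\<close>

lemma spectral_norm_transpose_le:
  fixes M :: "real^'n^'m"
  shows "spectral_norm (transpose M) \<le> spectral_norm M"
proof -
  have "norm (transpose M *v x) \<le> spectral_norm M * norm x" for x
  proof (cases "transpose M *v x = 0")
    case False
    let ?y = "transpose M *v x"
    have "norm ?y * norm ?y = inner x (M *v ?y)"
      by (simp only: inner_transpose_mult_vec [symmetric] dot_square_norm power2_eq_square)
    also have "\<dots> \<le> norm x * norm (M *v ?y)"
      by (rule norm_cauchy_schwarz)
    also have "\<dots> \<le> norm x * (spectral_norm M * norm ?y)"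
      by (intro mult_left_mono norm_mult_vec_le_spectral_norm norm_ge_zero)
    finally have "norm ?y * norm ?y \<le> (spectral_norm M * norm x) * norm ?y"
      by (simp only: mult_ac)
    with False show ?thesis
      by (metis mult_right_le_imp_le zero_less_norm_iff)
  qed (metis mult_nonneg_nonneg norm_ge_zero norm_zero spectral_norm_nonneg)
  then show ?thesis
    unfolding spectral_norm_def [of "transpose M"] by (rule onorm_le)
qed

lemma spectral_norm_transpose [simp]: "spectral_norm (transpose M) = spectral_norm M"
  using spectral_norm_transpose_le [of M] spectral_norm_transpose_le [of "transpose M"] by simp

section \<open>Invertibility and its stability under small perturbations\<close>

lemma matrix_inv_left_right:
  assumes "invertible M"
  shows "matrix_inv M ** M = mat 1" "M ** matrix_inv M = mat 1"
proof -
  have "M ** matrix_inv M = mat 1 \<and> matrix_inv M ** M = mat 1"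
    using assms unfolding invertible_def matrix_inv_def by (rule someI_ex)
  then show "matrix_inv M ** M = mat 1" "M ** matrix_inv M = mat 1" by auto
qed

lemma invertible_eqI:
  fixes M :: "real^'n^'n"
  assumes "invertible M" and "M ** X = M ** Y"
  shows "X = Y"
  by (metis assms matrix_inv_left_right(1) matrix_mul_assoc matrix_mul_lid)

lemma invertible_if_trivial_kernel:
  fixes M :: "real^'n^'n"
  assumes "\<And>x. M *v x = 0 \<Longrightarrow> x = 0"
  shows "invertible M"
  using assms by (simp add: invertible_left_inverse matrix_left_invertible_ker)

text \<open>A kernel vector has \<open>R *v x = - (E *v x)\<close>, so applying the inverse of
  \<open>R\<close> bounds \<open>norm x\<close> by itself times a factor below 1. This makes the
  perturbed preconditioner invertible.\<close>

lemma invertible_perturbation: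
  fixes R E :: "real^'n^'n"
  assumes "invertible R" and "spectral_norm E * spectral_norm (matrix_inv R) < 1"
  shows "invertible (R + E)"
proof (rule invertible_if_trivial_kernel)
  fix x assume "(R + E) *v x = 0"
  then have "R *v x = - (E *v x)"
    by (simp add: matrix_vector_mult_add_rdistrib eq_neg_iff_add_eq_0)
  then have "norm (R *v x) \<le> spectral_norm E * norm x"
    by (simp add: norm_mult_vec_le_spectral_norm)
  moreover have "x = matrix_inv R *v (R *v x)"
    by (simp add: matrix_vector_mul_assoc matrix_inv_left_right assms)
  then have "norm x \<le> spectral_norm (matrix_inv R) * norm (R *v x)"
    by (metis norm_mult_vec_le_spectral_norm)
  ultimately have "norm x \<le> spectral_norm (matrix_inv R) * (spectral_norm E * norm x)"
    by (meson mult_left_mono order_trans spectral_norm_nonneg)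
  then have "(1 - spectral_norm E * spectral_norm (matrix_inv R)) * norm x \<le> 0"
    by (simp add: algebra_simps)
  with assms(2) show "x = 0"
    by (simp add: mult_le_0_iff)
qed

section \<open>Gram matrices and the Moore-Penrose inverse\<close>

lemma invertible_gram:
  fixes M :: "real^'n^'m"
  assumes "inj ((*v) M)"
  shows "invertible (transpose M ** M)"
proof (rule invertible_if_trivial_kernel)
  fix x assume "(transpose M ** M) *v x = 0"
  then have "transpose M *v (M *v x) = 0"
    by (simp only: matrix_vector_mul_assoc)
  then have "inner (M *v x) (M *v x) = 0"
    by (metis inner_transpose_mult_vec inner_zero_left)
  then have "M *v x = M *v 0" by simp
  with assms show "x = 0" by (meson injD)
qed

context
  fixes M :: "real^'n^'m"
  assumes inj: "inj ((*v) M)"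
begin

lemma pinv_mult_self: "pinv M ** M = mat 1"
  by (metis pinv_def invertible_gram inj matrix_inv_left_right(1) matrix_mul_assoc)

lemma gram_mult_pinv: "(transpose M ** M) ** pinv M = transpose M"
  by (metis pinv_def invertible_gram inj matrix_inv_left_right(2) matrix_mul_assoc matrix_mul_lid)

text \<open>Invertibility of the Gram matrix makes the solution of this matrix equation unique, so a
  candidate formula for \<open>pinv\<close> need only be checked against it.\<close>

lemma pinv_eqI: "(transpose M ** M) ** X = transpose M \<Longrightarrow> pinv M = X"
  by (metis gram_mult_pinv inj invertible_eqI invertible_gram)

text \<open>Transposing \<open>pinv M ** M = mat 1\<close> shows that
  \<open>transpose M ** transpose (pinv M)\<close> is the identity; insert it to the right of the
  inverse Gram matrix. The spectral norm of that inverse is thus at most the square of that of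
  \<open>pinv M\<close>.\<close>

lemma matrix_inv_gram: "matrix_inv (transpose M ** M) = pinv M ** transpose (pinv M)"
  by (metis pinv_def pinv_mult_self matrix_mul_assoc matrix_mul_rid matrix_transpose_mul transpose_mat)

end

lemma pinv_invertible:
  fixes R :: "real^'n^'n"
  assumes "invertible R"
  shows "pinv R = matrix_inv R"
proof (rule pinv_eqI)
  show "inj ((*v) R)"
    using assms invertible_left_inverse matrix_left_invertible_injective by blast
  show "(transpose R ** R) ** matrix_inv R = transpose R"
    by (metis assms matrix_inv_left_right(2) matrix_mul_assoc matrix_mul_rid)
qed

text \<open>In the equation of \<open>pinv_eqI\<close>, the square factor \<open>R\<close> meets its
  inverse and cancels, leaving the corresponding equation for \<open>M\<close>.\<close>

lemma pinv_mult_invertible: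
  fixes M :: "real^'n^'m" and R :: "real^'n^'n"
  assumes M: "inj ((*v) M)" and R: "invertible R"
  shows "pinv (M ** R) = matrix_inv R ** pinv M"
proof (rule pinv_eqI)
  have "inj ((*v) R)"
    using R invertible_left_inverse matrix_left_invertible_injective by blast
  with M have "inj ((*v) M \<circ> (*v) R)" by (rule inj_compose)
  then show "inj ((*v) (M ** R))"
    by (simp add: o_def matrix_vector_mul_assoc)
  have "(transpose (M ** R) ** (M ** R)) ** (matrix_inv R ** pinv M)
      = transpose R ** ((transpose M ** M) ** (R ** matrix_inv R) ** pinv M)"
    by (simp add: matrix_transpose_mul matrix_mul_assoc)
  also have "\<dots> = transpose (M ** R)"
    using gram_mult_pinv [OF M] by (simp add: matrix_inv_left_right R matrix_transpose_mul)
  finally show "(transpose (M ** R) ** (M ** R)) ** (matrix_inv R ** pinv M) = transpose (M ** R)" .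
qed

section \<open>Condition numbers and perturbed normal equations\<close>

lemma cond_num_nonneg [simp]: "0 \<le> cond_num M"
  by (simp add: cond_num_def)

lemma cond_num_mult_invertible_le:
  fixes M :: "real^'n^'m" and R :: "real^'n^'n"
  assumes "inj ((*v) M)" and "invertible R"
  shows "cond_num (M ** R) \<le> cond_num R * cond_num M"
proof -
  have "cond_num (M ** R)
      \<le> (spectral_norm M * spectral_norm R) * (spectral_norm (matrix_inv R) * spectral_norm (pinv M))"
    unfolding cond_num_def pinv_mult_invertible [OF assms]
    by (intro mult_mono spectral_norm_mult mult_nonneg_nonneg spectral_norm_nonneg)
  then show ?thesis
    by (simp add: cond_num_def pinv_invertible assms mult_ac)
qed

text \<open>Since \<open>(M ** matrix_inv R) ** R = M\<close>, the substituted unknown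
  \<open>R *v x\<close> makes the residual unpreconditioned; multiplying by
  \<open>transpose R\<close> then removes the preconditioner on the left.\<close>

lemma normal_equations_unprecondition:
  fixes M :: "real^'n^'m" and R :: "real^'n^'n"
  assumes "invertible R"
    and "(transpose (M ** matrix_inv R) ** (M ** matrix_inv R)) *v (R *v x)
       = transpose (M ** matrix_inv R) *v b"
  shows "transpose M *v (M *v x - b) = 0"
proof -
  let ?P = "M ** matrix_inv R"
  have M: "?P ** R = M"
    by (metis assms(1) matrix_inv_left_right(1) matrix_mul_assoc matrix_mul_rid)
  have "transpose ?P *v ((?P ** R) *v x) = transpose ?P *v b"
    using assms(2) by (simp only: matrix_vector_mul_assoc matrix_mul_assoc)
  then have "transpose ?P *v (M *v x - b) = 0"
    by (simp only: M matrix_vector_mult_diff_distrib right_minus_eq)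
  then have "transpose R *v (transpose ?P *v (M *v x - b)) = 0"
    by (simp only: matrix_vector_mult_0_right)
  then show ?thesis
    by (simp only: matrix_vector_mul_assoc matrix_transpose_mul [symmetric] M)
qed

lemma least_squares_perturbation_bound:
  fixes A E :: "real^'n^'m"
  assumes inj: "inj ((*v) A)"
    and x: "transpose A *v (A *v x - b) = 0"
    and z: "transpose (A + E) *v ((A + E) *v z - b) = 0"
  shows "norm (z - x) \<le> spectral_norm (pinv A) * spectral_norm E * norm z
    + (spectral_norm (pinv A))\<^sup>2 * spectral_norm E * (norm (A *v z - b) + spectral_norm E * norm z)"
proof -
  let ?G = "transpose A ** A" and ?P = "pinv A" and ?s = "spectral_norm (pinv A)"
  \<comment> \<open>The residual of \<open>z\<close> in the perturbed problem.\<close>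
  define w where "w = A *v z - b + E *v z"
  have tadd: "transpose (A + E) = transpose A + transpose E"
    by (simp add: transpose_def vec_eq_iff)
  have "(A + E) *v z - b = w"
    by (simp add: w_def matrix_vector_mult_add_rdistrib)
  \<comment> \<open>The perturbed normal equations trade \<open>transpose A\<close> for
    \<open>transpose E\<close>, which supplies the factor \<open>spectral_norm E\<close> in the
    residual term.\<close>
  with z have zw: "transpose A *v w = - (transpose E *v w)"
    by (simp only: tadd matrix_vector_mult_add_rdistrib add_eq_0_iff2)
  \<comment> \<open>Expand \<open>w\<close> around \<open>x\<close>: the middle summand is the
    unperturbed residual, which \<open>transpose A\<close> annihilates.\<close>
  have "transpose A *v w = transpose A *v (A *v (z - x) + (A *v x - b) + E *v z)"
    by (simp only: w_def matrix_vector_mult_diff_distrib) (simp add: algebra_simps)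
  also have "\<dots> = ?G *v (z - x) + transpose A *v (E *v z)"
    using x by (simp only: matrix_vector_right_distrib matrix_vector_mul_assoc) simp
  finally have "?G *v (z - x) = - (transpose E *v w) - transpose A *v (E *v z)"
    using zw by (simp only: eq_diff_eq)
  then have "(matrix_inv ?G ** ?G) *v (z - x)
      = matrix_inv ?G *v (- (transpose E *v w) - transpose A *v (E *v z))"
    by (simp only: matrix_vector_mul_assoc [symmetric])
  also have "\<dots> = matrix_inv ?G *v (- (transpose E *v w)) - ?P *v (E *v z)"
    by (simp only: matrix_vector_mult_diff_distrib matrix_vector_mul_assoc matrix_mul_assoc pinv_def)
  finally have "z - x = matrix_inv ?G *v (- (transpose E *v w)) - ?P *v (E *v z)"
    by (simp only: matrix_inv_left_right invertible_gram inj matrix_vector_mul_lid)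
  then have diff: "z - x = ?P *v (transpose ?P *v (- (transpose E *v w))) - ?P *v (E *v z)"
    by (simp only: matrix_inv_gram [OF inj] matrix_vector_mul_assoc)
  have "norm (?P *v (transpose ?P *v (- (transpose E *v w))))
      \<le> ?s * norm (transpose ?P *v (- (transpose E *v w)))"
    by (rule norm_mult_vec_le_spectral_norm)
  also have "\<dots> \<le> ?s * (?s * norm (- (transpose E *v w)))"
    using norm_mult_vec_le_spectral_norm [of "transpose ?P"]
    by (intro mult_left_mono) (simp_all only: spectral_norm_transpose spectral_norm_nonneg)
  also have "\<dots> \<le> ?s * (?s * (spectral_norm E * norm w))"
    using norm_mult_vec_le_spectral_norm [of "transpose E" w]
    by (intro mult_left_mono) (simp_all only: spectral_norm_transpose spectral_norm_nonneg norm_minus_cancel)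
  also have "\<dots> \<le> ?s * (?s * (spectral_norm E * (norm (A *v z - b) + spectral_norm E * norm z)))"
    unfolding w_def
    by (intro mult_left_mono spectral_norm_nonneg norm_triangle_mono norm_mult_vec_le_spectral_norm order_refl)
  finally have *: "norm (?P *v (transpose ?P *v (- (transpose E *v w)))) \<le> \<dots>" .
  have "norm (?P *v (E *v z)) \<le> ?s * norm (E *v z)"
    by (rule norm_mult_vec_le_spectral_norm)
  also have "\<dots> \<le> ?s * (spectral_norm E * norm z)"
    by (intro mult_left_mono norm_mult_vec_le_spectral_norm spectral_norm_nonneg)
  finally have **: "norm (?P *v (E *v z)) \<le> ?s * (spectral_norm E * norm z)" .
  have "norm (z - x) \<le> norm (?P *v (transpose ?P *v (- (transpose E *v w)))) + norm (?P *v (E *v z))"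
    unfolding diff by (rule norm_triangle_ineq4)
  with * ** show ?thesis
    by (simp only: power2_eq_square mult.assoc)
qed

theorem theorem3p2:
  fixes A E_A A_p A_1 :: "real^'n^'m"
    and R_s E_s :: "real^'n^'n"
    and b :: "real^'m"
    and x_star y_star x_hat y_hat :: "real^'n"
    and eps_s eps_A :: real
  assumes "rank A = CARD('n)"
    and "invertible R_s"
    and "A_p = A ** matrix_inv R_s"
    and "(transpose A_p ** A_p) *v y_star = transpose A_p *v b"
    and "R_s *v x_star = y_star"
    and "spectral_norm E_s * spectral_norm (matrix_inv R_s) < 1"
    and "A_1 = (A + E_A) ** matrix_inv (R_s + E_s)"
    and "eps_s = spectral_norm E_s / spectral_norm R_s"
    and "eps_A = spectral_norm E_A / spectral_norm A"
    and "(transpose A_1 ** A_1) *v y_hat = transpose A_1 *v b"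
    and "(R_s + E_s) *v x_hat = y_hat"
    and "x_hat \<noteq> 0"
    and "y_hat \<noteq> 0"
  shows "norm (x_hat - x_star) / norm x_hat
    \<le> cond_num R_s * cond_num A_p * eps_A *
      (cond_num A_p * cond_num R_s * (norm (A *v x_hat - b) / (spectral_norm A * norm x_hat))
        + 1 + cond_num A * eps_A)"
proof -
  let ?k = "cond_num A" and ?K = "cond_num R_s * cond_num A_p"
    and ?\<rho> = "norm (A *v x_hat - b) / (spectral_norm A * norm x_hat)"
  let ?a = "spectral_norm A" and ?s = "spectral_norm (pinv A)" and ?e = "spectral_norm E_A"
  have inj: "inj ((*v) A)"
    using assms(1) by (simp only: full_rank_injective)
  have A: "A = A_p ** R_s"
    by (metis assms(2,3) matrix_inv_left_right(1) matrix_mul_assoc matrix_mul_rid)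
  have "inj ((*v) (matrix_inv R_s))"
    using assms(2) by (metis matrix_inv_left_right(2) matrix_left_invertible_injective)
  with inj have "inj ((*v) A \<circ> (*v) (matrix_inv R_s))" by (rule inj_compose)
  then have "inj ((*v) A_p)"
    by (simp add: assms(3) o_def matrix_vector_mul_assoc)
  then have kK: "?k \<le> ?K"
    unfolding A using assms(2) by (rule cond_num_mult_invertible_le)
  \<comment> \<open>The rank is \<open>CARD('n)\<close>, which is positive; this justifies dividing
    by \<open>spectral_norm A\<close>.\<close>
  have "A \<noteq> 0"
    using assms(1) by (metis rank_0 zero_less_card_finite less_irrefl)
  then have a: "0 < ?a" by (rule spectral_norm_pos)
  have h: "0 < norm x_hat" using assms(12) by simp
  have eps: "0 \<le> eps_A" by (simp add: assms(9))
  have \<rho>: "0 \<le> ?\<rho>" by simp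
  have star: "transpose A *v (A *v x_star - b) = 0"
    using assms(2-5) by (intro normal_equations_unprecondition) auto
  \<comment> \<open>\<open>E_s\<close> cancels together with the perturbed preconditioner, so only
    \<open>E_A\<close> perturbs the least squares problem.\<close>
  have hat: "transpose (A + E_A) *v ((A + E_A) *v x_hat - b) = 0"
    using assms(2,6,7,10,11)
    by (intro normal_equations_unprecondition [of "R_s + E_s"] invertible_perturbation) auto
  have "norm (x_hat - x_star) / norm x_hat
      \<le> (?s * ?e * norm x_hat + ?s\<^sup>2 * ?e * (norm (A *v x_hat - b) + ?e * norm x_hat)) / norm x_hat"
    using least_squares_perturbation_bound [OF inj star hat] by (rule divide_right_mono) simp
  \<comment> \<open>Each \<open>?s * ?e\<close> equals \<open>?k * eps_A\<close>, and
    \<open>?s * norm (A *v x_hat - b) / norm x_hat\<close> equals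
    \<open>?k * ?\<rho>\<close>.\<close>
  also have "\<dots> = ?k * eps_A * (?k * ?\<rho> + 1 + ?k * eps_A)"
    using a h by (simp add: cond_num_def assms(9) field_simps power2_eq_square)
  \<comment> \<open>The outer factor and the coefficient of \<open>?\<rho>\<close> grow to
    \<open>?K\<close>; the last summand keeps \<open>?k\<close>, as the claim demands.\<close>
  also have "\<dots> \<le> ?K * eps_A * (?K * ?\<rho> + 1 + ?k * eps_A)"
    using kK eps \<rho> by (intro mult_mono add_mono) (auto intro!: add_nonneg_nonneg mult_nonneg_nonneg)
  finally show ?thesis by (simp only: mult_ac)
qed

end
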